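(* For every integer $n\geq 5$ we have $\mathrm{sat}^*(n,\mathcal A_5)=4n-2$.
   Context: A family $\mathcal F$ of subsets of $[n]=\{1,\ldots,n\}$ is called $k$-antichain saturated if $\mathcal F$ does not contain $k$ pairwise incomparable (with respect to inclusion) sets, but for every set $X\subseteq[n]$ with $X\notin\mathcal F$, the family $\mathcal F\cup\{X\}$ contains $k$ pairwise incomparable sets. $\mathrm{sat}^*(n,\mathcal A_k)$ denotes the minimum size of a $k$-antichain saturated family of subsets of $[n]$. *)

theory Defs
  imports Main
begin

definition antichain :: "'a set set \<Rightarrow> bool" where
  "antichain A \<longleftrightarrow> pairwise (\<lambda>X Y. \<not> X \<subseteq> Y \<and> \<not> Y \<subseteq> X) A"

definition contains_antichain :: "nat \<Rightarrow> 'a set set \<Rightarrow> bool" where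
  "contains_antichain k F \<longleftrightarrow> (\<exists>A\<subseteq>F. finite A \<and> card A = k \<and> antichain A)"

definition antichain_saturated :: "nat \<Rightarrow> nat \<Rightarrow> nat set set \<Rightarrow> bool" where
  "antichain_saturated n k F \<longleftrightarrow>
     F \<subseteq> Pow {1..n} \<and>
     \<not> contains_antichain k F \<and>
     (\<forall>X. X \<subseteq> {1..n} \<longrightarrow> X \<notin> F \<longrightarrow> contains_antichain k (F \<union> {X}))"

definition sat_star :: "nat \<Rightarrow> nat \<Rightarrow> nat" where
  "sat_star n k = (LEAST m. \<exists>F. antichain_saturated n k F \<and> card F = m)"

text \<open>For \<open>k \<ge> 1\<close> the minimum ranges over a nonempty set and is therefore attained.\<close>

lemma antichain_saturated_exists:
  assumes "k \<ge> 1"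
  shows "\<exists>F. antichain_saturated n k F"
proof -
  let ?S = "{F. F \<subseteq> Pow {1..n} \<and> \<not> contains_antichain k F}"
  have "finite ?S"
    by (rule finite_subset[of _ "Pow (Pow {1..n})"]) auto
  moreover have "{} \<in> ?S"
    using assms by (auto simp: contains_antichain_def)
  ultimately obtain F where F: "F \<in> ?S" and max: "\<And>G. G \<in> ?S \<Longrightarrow> F \<subseteq> G \<Longrightarrow> F = G"
    using finite_has_maximal[of ?S] by (metis (no_types, lifting) empty_iff)
  have "contains_antichain k (F \<union> {X})" if "X \<subseteq> {1..n}" "X \<notin> F" for X
  proof (rule ccontr)
    assume "\<not> contains_antichain k (F \<union> {X})"
    then have "F \<union> {X} \<in> ?S" using F that by auto
    then have "F = F \<union> {X}" by (rule max) auto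
    then show False using that by auto
  qed
  then have "antichain_saturated n k F"
    using F by (simp add: antichain_saturated_def)
  then show ?thesis ..
qed

lemma sat_star_attained:
  assumes "k \<ge> 1"
  shows "\<exists>F. antichain_saturated n k F \<and> card F = sat_star n k"
proof -
  obtain F where "antichain_saturated n k F"
    using antichain_saturated_exists[OF assms] ..
  then have "\<exists>G. antichain_saturated n k G \<and> card G = card F" by auto
  then show ?thesis unfolding sat_star_def by (rule LeastI)
qed

end

theory Submission
  imports Defs "HOL-Combinatorics.Transposition"
begin

text \<open>
  Four chains of cyclic intervals, with starting points 1, 2, 3, 4, meet every layer strictly
  between bottom and top in four sets. Together with bottom and top they form a saturated family,
  since a new set is incomparable to the four members of its own layer.

  Conversely, a saturated family without bottom and top splits into four chains by Dilworth, and it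
  suffices that no chain skips a layer. If \<open>A \<subset> B\<close> are consecutive in a chain, then by maximality
  every set strictly between them lies in the family, hence on one of the other three chains.
  Exchanging the upper part of this chain with that of another chain through such a set \<open>M\<close> produces
  a new gap, from the predecessor of \<open>M\<close> to \<open>B\<close>, to which the same argument applies. As there are
  only three other chains, two different predecessors are forced to coincide, unless \<open>A\<close> is the
  bottom. The case where \<open>A\<close> is the bottom is dual, because then \<open>B\<close> is not the top.
\<close>

section \<open>Chain colourings and Dilworth's theorem\<close>

definition chain_colouring :: "'a set set \<Rightarrow> nat \<Rightarrow> ('a set \<Rightarrow> nat) \<Rightarrow> bool" where
  "chain_colouring G k c \<longleftrightarrow>
     c ` G \<subseteq> {..<k} \<and> (\<forall>X\<in>G. \<forall>Y\<in>G. c X = c Y \<longrightarrow> X \<subseteq> Y \<or> Y \<subseteq> X)"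

lemma chain_colouring_less: "chain_colouring G k c \<Longrightarrow> X \<in> G \<Longrightarrow> c X < k"
  by (auto simp: chain_colouring_def)

lemma chain_colouring_comparable:
  "chain_colouring G k c \<Longrightarrow> X \<in> G \<Longrightarrow> Y \<in> G \<Longrightarrow> c X = c Y \<Longrightarrow> X \<subseteq> Y \<or> Y \<subseteq> X"
  by (auto simp: chain_colouring_def)

lemma antichainD: "antichain A \<Longrightarrow> X \<in> A \<Longrightarrow> Y \<in> A \<Longrightarrow> X \<subseteq> Y \<Longrightarrow> X = Y"
  unfolding antichain_def pairwise_def by blast

lemma antichainI: "(\<And>X Y. X \<in> A \<Longrightarrow> Y \<in> A \<Longrightarrow> X \<subseteq> Y \<Longrightarrow> X = Y) \<Longrightarrow> antichain A"
  unfolding antichain_def pairwise_def by blast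

lemma chain_colouring_inj_on_antichain:
  assumes "chain_colouring G k c" "A \<subseteq> G" "antichain A"
  shows "inj_on c A"
proof (rule inj_onI)
  fix X Y assume "X \<in> A" "Y \<in> A" "c X = c Y"
  then show "X = Y"
    using chain_colouring_comparable[OF assms(1), of X Y] assms(2) antichainD[OF assms(3)] by blast
qed

lemma chain_colouring_card_antichain:
  assumes "chain_colouring G k c" "A \<subseteq> G" "antichain A"
  shows "card A \<le> k"
proof -
  have "c ` A \<subseteq> {..<k}" using assms by (auto simp: chain_colouring_def)
  then have "card (c ` A) \<le> k" using card_mono[of "{..<k}" "c ` A"] by simp
  then show ?thesis using card_image[OF chain_colouring_inj_on_antichain[OF assms]] by simp
qed

lemma chain_colouring_not_contains_antichain:
  "chain_colouring G k c \<Longrightarrow> \<not> contains_antichain (Suc k) G"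
  unfolding contains_antichain_def by (metis chain_colouring_card_antichain not_less_eq_eq order_refl)

lemma chain_colouring_add_chain:
  assumes d: "chain_colouring (P - K) m d"
    and K: "\<And>X Y. X \<in> K \<Longrightarrow> Y \<in> K \<Longrightarrow> X \<subseteq> Y \<or> Y \<subseteq> X"
  shows "chain_colouring P (Suc m) (\<lambda>X. if X \<in> K then m else d X)"
proof -
  have "d X < m" if "X \<in> P" "X \<notin> K" for X
    using chain_colouring_less[OF d] that by blast
  then show ?thesis
    using d K unfolding chain_colouring_def
    by (auto simp: less_Suc_eq image_subset_iff split: if_splits; blast)
qed

lemma finite_chain_has_greatest:
  fixes S :: "'a set set"
  assumes "finite S" "S \<noteq> {}" "\<And>X Y. X \<in> S \<Longrightarrow> Y \<in> S \<Longrightarrow> X \<subseteq> Y \<or> Y \<subseteq> X"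
  shows "\<exists>M\<in>S. \<forall>X\<in>S. X \<subseteq> M"
proof -
  obtain M where M: "M \<in> S" "\<forall>X\<in>S. M \<subseteq> X \<longrightarrow> M = X"
    using finite_has_maximal[OF assms(1,2)] by (elim bexE)
  have "\<forall>X\<in>S. X \<subseteq> M" using M assms(3)[OF M(1)] by (metis order_refl)
  then show ?thesis using M(1) by (rule bexI)
qed

lemma finite_chain_has_least:
  fixes S :: "'a set set"
  assumes "finite S" "S \<noteq> {}" "\<And>X Y. X \<in> S \<Longrightarrow> Y \<in> S \<Longrightarrow> X \<subseteq> Y \<or> Y \<subseteq> X"
  shows "\<exists>M\<in>S. \<forall>X\<in>S. M \<subseteq> X"
proof -
  obtain M where M: "M \<in> S" "\<forall>X\<in>S. X \<subseteq> M \<longrightarrow> M = X"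
    using finite_has_minimal[OF assms(1,2)] by (elim bexE)
  have "\<forall>X\<in>S. M \<subseteq> X" using M assms(3)[OF M(1)] by (metis order_refl)
  then show ?thesis using M(1) by (rule bexI)
qed

text \<open>The induction removes a maximal set \<open>a\<close>. If the rest has no antichain of
  size \<open>k\<close>, then \<open>a\<close> is a chain by itself. Otherwise a chain
  \<open>K\<close> through \<open>a\<close> is found that meets every antichain of size
  \<open>k\<close>, and \<open>P - K\<close> needs one colour fewer.\<close>

theorem dilworth:
  fixes P :: "'a set set"
  assumes "finite P" "\<not> contains_antichain (Suc k) P"
  shows "\<exists>c. chain_colouring P k c"
  using assms
proof (induction P arbitrary: k rule: finite_psubset_induct)
  case (psubset P)
  show ?case
  proof (cases "P = {}")
    case True
    then show ?thesis by (auto simp: chain_colouring_def)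
  next
    case False
    then obtain a where a: "a \<in> P" and a_max: "\<And>X. X \<in> P \<Longrightarrow> a \<subseteq> X \<Longrightarrow> a = X"
      using finite_has_maximal[OF psubset.hyps] by blast
    have "contains_antichain 1 P"
      unfolding contains_antichain_def
      by (rule exI[of _ "{a}"]) (use a in \<open>auto simp: antichain_def\<close>)
    then obtain m where k: "k = Suc m"
      using psubset.prems by (cases k) auto
    define P' where "P' = P - {a}"
    have P': "P' \<subset> P" using a by (auto simp: P'_def)
    show ?thesis
    proof (cases "contains_antichain (Suc m) P'")
      case False
      then obtain d where "chain_colouring (P - {a}) m d"
        using psubset.IH[OF P'] P'_def by blast
      from chain_colouring_add_chain[OF this] show ?thesis using k by auto
    next
      case True
      have "\<not> contains_antichain (Suc k) P'"
        using psubset.prems P' unfolding contains_antichain_def by (meson psubset_imp_subset subset_trans)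
      then obtain c where c: "chain_colouring P' k c" using psubset.IH[OF P'] by blast
      \<comment> \<open>Galvin's argument: the top elements \<open>x i\<close> of the colour classes among members of
        maximum antichains form an antichain themselves.\<close>
      define E where "E = {A. A \<subseteq> P' \<and> finite A \<and> card A = k \<and> antichain A}"
      have full: "\<exists>y\<in>A. c y = i" if "A \<in> E" "i < k" for A i
      proof -
        have A: "A \<subseteq> P'" "card A = k" "antichain A" using that by (auto simp: E_def)
        have "c ` A = {..<k}"
          using A c card_image[OF chain_colouring_inj_on_antichain[OF c A(1,3)]]
          by (intro card_subset_eq) (auto simp: chain_colouring_def)
        then show ?thesis using that by (metis imageE lessThan_iff)
      qed
      obtain A0 where A0: "A0 \<in> E"
        using True k unfolding contains_antichain_def E_def by blast
      have EP: "\<Union>E \<subseteq> P'" by (auto simp: E_def)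
      have finP': "finite P'" using psubset.hyps P' by (auto intro: finite_subset)
      have "\<exists>M. M \<in> \<Union>E \<and> c M = i \<and> (\<forall>X\<in>\<Union>E. c X = i \<longrightarrow> X \<subseteq> M)" if "i < k" for i
      proof -
        let ?W = "{X \<in> \<Union>E. c X = i}"
        have "finite ?W" by (rule finite_subset[OF _ finP']) (use EP in blast)
        moreover have "?W \<noteq> {}" using full[OF A0 that] A0 by blast
        moreover have "\<And>X Y. X \<in> ?W \<Longrightarrow> Y \<in> ?W \<Longrightarrow> X \<subseteq> Y \<or> Y \<subseteq> X"
          using chain_colouring_comparable[OF c] EP
          by (metis (mono_tags, lifting) mem_Collect_eq subsetD)
        ultimately have "\<exists>M\<in>?W. \<forall>X\<in>?W. X \<subseteq> M" by (rule finite_chain_has_greatest)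
        then show ?thesis by blast
      qed
      then obtain x where x: "\<And>i. i < k \<Longrightarrow> x i \<in> \<Union>E" "\<And>i. i < k \<Longrightarrow> c (x i) = i"
        and x_max: "\<And>i X. i < k \<Longrightarrow> X \<in> \<Union>E \<Longrightarrow> c X = i \<Longrightarrow> X \<subseteq> x i"
        by metis
      \<comment> \<open>An antichain of size \<open>k\<close> through \<open>x j\<close> has a
        member \<open>y\<close> of colour \<open>i\<close>, and \<open>y \<subseteq> x i\<close> by
        the choice of \<open>x i\<close>. So \<open>x i \<subseteq> x j\<close> puts
        \<open>y\<close> below \<open>x j\<close> within one antichain.\<close>
      have x_anti: "i = j" if ij: "i < k" "j < k" "x i \<subseteq> x j" for i j
      proof -
        obtain A where A: "A \<in> E" "x j \<in> A" using x(1)[OF ij(2)] by blast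
        obtain y where y: "y \<in> A" "c y = i" using full[OF A(1) ij(1)] by blast
        have "y \<subseteq> x j" using x_max[OF ij(1) _ y(2)] y A ij by blast
        moreover have "antichain A" using A by (auto simp: E_def)
        ultimately have "y = x j" using antichainD y A by blast
        then show ?thesis using y x(2)[OF ij(2)] by simp
      qed
      have "\<exists>i<k. x i \<subseteq> a"
      proof (rule ccontr)
        assume no: "\<not> (\<exists>i<k. x i \<subseteq> a)"
        let ?A = "insert a (x ` {..<k})"
        have xP: "x i \<in> P'" if "i < k" for i using x(1)[OF that] EP by blast
        have "inj_on x {..<k}" using x_anti by (auto intro!: inj_onI)
        then have "card (x ` {..<k}) = k" by (simp add: card_image)
        moreover have "a \<notin> x ` {..<k}" using no by auto
        ultimately have "card ?A = Suc k" by simp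
        moreover have "antichain ?A"
        proof (rule antichainI)
          fix X Y assume "X \<in> ?A" "Y \<in> ?A" "X \<subseteq> Y"
          moreover have "a = x i" if "i < k" "a \<subseteq> x i" for i
            using a_max[of "x i"] xP[of i] P' that by blast
          ultimately show "X = Y" using no x_anti by (elim insertE imageE) (simp, blast+)
        qed
        moreover have "?A \<subseteq> P" using a xP P' by auto
        ultimately show False
          using psubset.prems unfolding contains_antichain_def by (metis finite_imageI finite_insert finite_lessThan)
      qed
      then obtain i where i: "i < k" "x i \<subseteq> a" by blast
      \<comment> \<open>Cutting colour \<open>i\<close> at \<open>x i\<close> makes \<open>K\<close>
        a chain below \<open>a\<close>, and the part kept still meets every antichain of size
        \<open>k\<close> in \<open>P'\<close>.\<close>
      define K where "K = insert a {z \<in> P'. c z = i \<and> z \<subseteq> x i}"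
      have "P - K \<subset> P" using a by (auto simp: K_def)
      moreover have "\<not> contains_antichain (Suc m) (P - K)"
      proof
        assume "contains_antichain (Suc m) (P - K)"
        then obtain A where A: "A \<subseteq> P - K" "finite A" "card A = k" "antichain A"
          unfolding contains_antichain_def k by blast
        then have "A \<in> E" by (auto simp: E_def P'_def K_def)
        then obtain y where y: "y \<in> A" "c y = i" using full i by blast
        then have "y \<in> K"
          using x_max[OF i(1) _ y(2)] \<open>A \<in> E\<close> by (auto simp: K_def E_def)
        then show False using y A by blast
      qed
      ultimately obtain d where d: "chain_colouring (P - K) m d" using psubset.IH by blast
      have "X \<subseteq> Y \<or> Y \<subseteq> X" if "X \<in> K" "Y \<in> K" for X Y
        using that i chain_colouring_comparable[OF c] unfolding K_def by (auto; blast)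
      from chain_colouring_add_chain[OF d this] show ?thesis using k by blast
    qed
  qed
qed

section \<open>Gaps in four chains and their rerouting\<close>

text \<open>Two consecutive members of a colour class, where every colour class is extended by the
  bottom \<open>{}\<close> and the top \<open>V\<close>.\<close>

definition gap :: "'a set \<Rightarrow> 'a set set \<Rightarrow> ('a set \<Rightarrow> nat) \<Rightarrow> nat \<Rightarrow> 'a set \<Rightarrow> 'a set \<Rightarrow> bool" where
  "gap V G c p A B \<longleftrightarrow> p < 4 \<and> A \<subset> B \<and> B \<subseteq> V \<and> (A = {} \<or> A \<in> G \<and> c A = p) \<and>
     (B = V \<or> B \<in> G \<and> c B = p) \<and> (\<forall>X\<in>G. c X = p \<longrightarrow> X \<subseteq> A \<or> B \<subseteq> X)"

lemma
  assumes "gap V G c p A B"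
  shows gap_less: "p < 4" and gap_psubset: "A \<subset> B" and gap_subset: "B \<subseteq> V"
    and gap_bottom: "A = {} \<or> A \<in> G \<and> c A = p" and gap_top: "B = V \<or> B \<in> G \<and> c B = p"
  using assms by (simp_all add: gap_def)

lemma gap_side: "gap V G c p A B \<Longrightarrow> X \<in> G \<Longrightarrow> c X = p \<Longrightarrow> X \<subseteq> A \<or> B \<subseteq> X"
  by (simp add: gap_def)

text \<open>Since colours stand for chains, exchanging the parts of two chains from level
  \<open>L\<close> upwards is a transposition of colours on the sets of size at least
  \<open>L\<close>.\<close>

definition swap_tops :: "nat \<Rightarrow> nat \<Rightarrow> nat \<Rightarrow> ('a set \<Rightarrow> nat) \<Rightarrow> 'a set \<Rightarrow> nat" where
  "swap_tops L p q c X = (if card X < L then c X else transpose p q (c X))"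

text \<open>Saturation, stripped of bottom and top and translated from antichains to chains, so that
  membership of a set can be shown by placing it on a chain. The conditions are invariant under
  complementation.\<close>

locale maximal_family =
  fixes V :: "'a set" and G :: "'a set set"
  assumes finV: "finite V"
    and GV: "G \<subseteq> Pow V - {{}, V}"
    and max: "X \<subset> V \<Longrightarrow> X \<noteq> {} \<Longrightarrow> chain_colouring (insert X G) 4 c \<Longrightarrow> X \<in> G"
begin

lemma finite_member: "X \<in> G \<Longrightarrow> finite X"
  using GV finV by (auto intro: finite_subset)

lemma finite_family: "finite G"
  by (rule finite_subset[OF GV]) (simp add: finV)

lemma same_card_same_colour:
  assumes "chain_colouring G 4 c" "X \<in> G" "Y \<in> G" "card X = card Y" "c X = c Y"
  shows "X = Y"
  using chain_colouring_comparable[OF assms(1-3,5)] assms(4)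
    card_subset_eq[OF finite_member[OF assms(2)], of Y] card_subset_eq[OF finite_member[OF assms(3)], of X]
  by auto

text \<open>Such an \<open>X\<close> is comparable to every set of colour \<open>p\<close>, so it
  can be added to that chain and maximality applies. It cannot have colour \<open>p\<close>, as this
  chain has nothing strictly inside the gap.\<close>

lemma gap_between:
  assumes c: "chain_colouring G 4 c" and g: "gap V G c p A B" and X: "A \<subset> X" "X \<subset> B"
  shows "X \<in> G" "c X \<noteq> p"
proof -
  have no: "X \<in> G \<Longrightarrow> c X \<noteq> p"
    using gap_side[OF g, of X] X by blast
  show XG: "X \<in> G"
  proof (rule ccontr)
    assume "X \<notin> G"
    have p: "p < 4" using g by (simp add: gap_def)
    have *: "Y \<subseteq> X \<or> X \<subseteq> Y" if "Y \<in> G" "c Y = p" for Y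
    proof -
      have "Y \<subseteq> A \<or> B \<subseteq> Y" using gap_side[OF g that] .
      then show ?thesis using X by blast
    qed
    have "chain_colouring (insert X G) 4 (c(X := p))"
      unfolding chain_colouring_def
    proof (intro conjI ballI impI)
      show "(c(X := p)) ` insert X G \<subseteq> {..<4}"
        using chain_colouring_less[OF c] p by auto
      fix Y Z assume "Y \<in> insert X G" "Z \<in> insert X G" "(c(X := p)) Y = (c(X := p)) Z"
      then show "Y \<subseteq> Z \<or> Z \<subseteq> Y"
        using *[of Y] *[of Z] chain_colouring_comparable[OF c, of Y Z]
        by (cases "Y = X"; cases "Z = X") auto
    qed
    moreover have "X \<subset> V" "X \<noteq> {}" using gap_subset[OF g] X by auto
    ultimately have "X \<in> G" by (rule max[rotated 2])
    then show False using \<open>X \<notin> G\<close> by blast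
  qed
  show "c X \<noteq> p" using no XG by blast
qed

lemma gap_at_level:
  assumes c: "chain_colouring G 4 c" and p: "p < 4" and L: "1 \<le> L" "L \<le> card V"
  obtains A B where "gap V G c p A B" "card A < L" "L \<le> card B"
proof -
  \<comment> \<open>\<open>{}\<close> and \<open>V\<close> serve as default ends when the chain has
    no member on that side of level \<open>L\<close>; the bounds on \<open>L\<close> put them on the
    correct sides.\<close>
  let ?S = "insert {} {X \<in> G. c X = p \<and> card X < L}"
  let ?T = "insert V {X \<in> G. c X = p \<and> L \<le> card X}"
  have comp: "\<And>X Y. X \<in> G \<Longrightarrow> Y \<in> G \<Longrightarrow> c X = p \<Longrightarrow> c Y = p \<Longrightarrow> X \<subseteq> Y \<or> Y \<subseteq> X"
    using chain_colouring_comparable[OF c] by metis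
  have "\<exists>M\<in>?S. \<forall>X\<in>?S. X \<subseteq> M"
  proof (rule finite_chain_has_greatest)
    fix X Y assume "X \<in> ?S" "Y \<in> ?S"
    then show "X \<subseteq> Y \<or> Y \<subseteq> X" using comp[of X Y] by auto
  qed (use finite_family in simp_all)
  then obtain A where A: "A \<in> ?S" "\<forall>X\<in>?S. X \<subseteq> A" by (elim bexE)
  have "\<exists>M\<in>?T. \<forall>X\<in>?T. M \<subseteq> X"
  proof (rule finite_chain_has_least)
    fix X Y assume "X \<in> ?T" "Y \<in> ?T"
    moreover have "Z \<subseteq> V" if "Z \<in> ?T" for Z using that GV by auto
    ultimately show "X \<subseteq> Y \<or> Y \<subseteq> X" using comp[of X Y] by auto
  qed (use finite_family in simp_all)
  then obtain B where B: "B \<in> ?T" "\<forall>X\<in>?T. B \<subseteq> X" by (elim bexE)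
  have AL: "card A < L" using A(1) L by auto
  have BL: "L \<le> card B" using B(1) L by auto
  have "A \<subseteq> B"
  proof (cases "A = {} \<or> B = V")
    case True then show ?thesis using A(1) GV by auto
  next
    case False
    then have "A \<subseteq> B \<or> B \<subseteq> A" using A(1) B(1) comp[of A B] by auto
    moreover have "\<not> B \<subseteq> A"
      using AL BL A(1) False finite_member[of A] card_mono[of A B] by auto
    ultimately show ?thesis by blast
  qed
  then have "A \<subset> B" using AL BL by auto
  moreover have "B \<subseteq> V" using B(2) by simp
  moreover have "X \<subseteq> A \<or> B \<subseteq> X" if "X \<in> G" "c X = p" for X
    using bspec[OF A(2), of X] bspec[OF B(2), of X] that by (cases "card X < L") auto
  ultimately have "gap V G c p A B" using A(1) B(1) p unfolding gap_def by auto
  then show thesis using AL BL that by blast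
qed

text \<open>Both chains are cut at the same level, into a part below \<open>A\<close> or
  \<open>C\<close> and a part above \<open>B\<close> or \<open>D\<close>. The inclusions
  \<open>A \<subseteq> D\<close> and \<open>C \<subseteq> B\<close> are what makes the crosswise
  recombined parts chains again.\<close>

lemma chain_colouring_swap_tops:
  assumes c: "chain_colouring G 4 c"
    and g: "gap V G c p A B" "card A < L" "L \<le> card B"
    and h: "gap V G c q C D" "card C < L" "L \<le> card D"
    and pq: "p \<noteq> q" and AD: "A \<subseteq> D" and CB: "C \<subseteq> B"
  shows "chain_colouring G 4 (swap_tops L p q c)" "gap V G (swap_tops L p q c) q C B"
proof -
  let ?c = "swap_tops L p q c"
  note p = gap_less[OF g(1)] and q = gap_less[OF h(1)]
  note VB = gap_subset[OF g(1)] gap_subset[OF h(1)]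
  have fB: "finite B" "finite D" using VB finV by (auto dest: finite_subset)
  have fA: "finite A" "finite C" using finite_subset[OF AD fB(2)] finite_subset[OF CB fB(1)] by auto
  have low: "X \<subseteq> A" if "X \<in> G" "c X = p" "card X < L" for X
    using gap_side[OF g(1) that(1,2)] g(3) that(3) card_mono[OF finite_member[OF that(1)], of B] by linarith
  have high: "B \<subseteq> X" if "X \<in> G" "c X = p" "\<not> card X < L" for X
    using gap_side[OF g(1) that(1,2)] g(2) that(3) card_mono[OF fA(1), of X] by linarith
  have low': "X \<subseteq> C" if "X \<in> G" "c X = q" "card X < L" for X
    using gap_side[OF h(1) that(1,2)] h(3) that(3) card_mono[OF finite_member[OF that(1)], of D] by linarith
  have high': "D \<subseteq> X" if "X \<in> G" "c X = q" "\<not> card X < L" for X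
    using gap_side[OF h(1) that(1,2)] h(2) that(3) card_mono[OF fA(2), of X] by linarith
  have cross: "X \<subseteq> Y" if XY: "X \<in> G" "Y \<in> G" "card X < L" "\<not> card Y < L" "c X = transpose p q (c Y)" for X Y
  proof -
    consider "c Y = p" | "c Y = q" | "c Y \<noteq> p" "c Y \<noteq> q" by blast
    then show ?thesis
    proof cases
      case 1
      then have "c X = q" using XY by simp
      then show ?thesis using 1 low'[of X] high[of Y] XY CB by blast
    next
      case 2
      then have "c X = p" using XY by simp
      then show ?thesis using 2 low[of X] high'[of Y] XY AD by blast
    next
      case 3
      then have "c X = c Y" using XY by (simp add: transpose_def)
      then have "X \<subseteq> Y \<or> Y \<subseteq> X" using chain_colouring_comparable[OF c] XY by blast
      then show ?thesis using XY(3,4) card_mono[OF finite_member[OF XY(1)], of Y] by linarith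
    qed
  qed
  have "?c X < 4" if "X \<in> G" for X
    using chain_colouring_less[OF c that] p q by (auto simp: swap_tops_def transpose_def)
  moreover have "X \<subseteq> Y \<or> Y \<subseteq> X" if XY: "X \<in> G" "Y \<in> G" "?c X = ?c Y" for X Y
  proof (cases "card X < L \<longleftrightarrow> card Y < L")
    case True
    then have "c X = c Y" using XY(3) by (auto simp: swap_tops_def transpose_eq_iff)
    then show ?thesis using chain_colouring_comparable[OF c] XY by blast
  next
    case False
    then show ?thesis using cross[of X Y] cross[of Y X] XY by (auto simp: swap_tops_def)
  qed
  ultimately show "chain_colouring G 4 ?c" unfolding chain_colouring_def by blast
  have "X \<subseteq> C \<or> B \<subseteq> X" if "X \<in> G" "?c X = q" for X
    using that low'[of X] high[of X] by (auto simp: swap_tops_def transpose_def split: if_splits)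
  moreover have "C \<subset> B" using CB g(3) h(2) by auto
  moreover have "C = {} \<or> C \<in> G \<and> ?c C = q" using gap_bottom[OF h(1)] h(2) by (auto simp: swap_tops_def)
  moreover have "B = V \<or> B \<in> G \<and> ?c B = q" using gap_top[OF g(1)] g(3) by (auto simp: swap_tops_def)
  ultimately show "gap V G ?c q C B" using q VB(1) by (simp add: gap_def)
qed

text \<open>Cutting the chain of \<open>M\<close> at level \<open>card M\<close> gives the gap from
  the predecessor \<open>C\<close> of \<open>M\<close> up to \<open>M\<close> itself. As
  \<open>A \<subset> M\<close> and \<open>C \<subset> B\<close>, exchanging tops with chain
  \<open>p\<close> is possible and leaves a gap from \<open>C\<close> to \<open>B\<close>.\<close>

lemma reroute_gap:
  assumes c: "chain_colouring G 4 c" and g: "gap V G c p A B"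
    and M: "A \<subset> M" "M \<subset> B"
  obtains C where "C \<subset> M" "C = {} \<or> C \<in> G \<and> c C = c M"
    "chain_colouring G 4 (swap_tops (card M) p (c M) c)"
    "gap V G (swap_tops (card M) p (c M) c) (c M) C B"
proof -
  have MG: "M \<in> G" and cM: "c M \<noteq> p" using gap_between[OF c g M] by auto
  note BV = gap_subset[OF g]
  have fin: "finite M" "finite B" using finite_member[OF MG] finite_subset[OF BV finV] by auto
  have AM: "card A < card M" and MB: "card M < card B"
    using psubset_card_mono M fin by auto
  have "card M \<le> card V" using MB card_mono[OF finV BV] by simp
  then obtain C D where h: "gap V G c (c M) C D" "card C < card M" "card M \<le> card D"
    using gap_at_level[OF c chain_colouring_less[OF c MG], of "card M"] AM by auto
  have "C \<subseteq> V" using gap_psubset[OF h(1)] gap_subset[OF h(1)] by blast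
  \<comment> \<open>\<open>M\<close> lies on this chain, hence below \<open>C\<close> or above
    \<open>D\<close>; its size excludes the first and turns the second into equality.\<close>
  then have "\<not> M \<subseteq> C" using card_mono[OF finite_subset[OF _ finV], of C M] h(2) by auto
  then have "D \<subseteq> M" using gap_side[OF h(1) MG] by blast
  then have D: "D = M" using card_seteq[OF fin(1) _ h(3)] by blast
  have CM: "C \<subset> M" using gap_psubset[OF h(1)] D by simp
  have "A \<subseteq> D" "C \<subseteq> B" using D M CM by auto
  from chain_colouring_swap_tops[OF c g AM less_imp_le[OF MB] h cM[symmetric] this] show thesis
    using that[OF CM gap_bottom[OF h(1)]] by blast
qed

section \<open>Height of gaps with nonempty bottom\<close>

lemma gap_level_card:
  assumes c: "chain_colouring G 4 c" and g: "gap V G c p A B"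
    and L: "card A < L" "L < card B"
  shows "card {X \<in> G. card X = L} \<le> 3"
proof -
  let ?T = "{X \<in> G. card X = L}"
  note p = gap_less[OF g]
  have "A \<subseteq> V" using gap_psubset[OF g] gap_subset[OF g] by blast
  then have fin: "finite A" using finV by (rule finite_subset)
  \<comment> \<open>Chain \<open>p\<close> jumps over level \<open>L\<close>, and each of the other
    three chains has at most one set there.\<close>
  have "c X \<noteq> p" if "X \<in> ?T" for X
    using gap_side[OF g, of X] L that card_mono[OF fin, of X] card_mono[OF finite_member[of X], of B]
    by auto
  then have "c ` ?T \<subseteq> {..<4} - {p}" using chain_colouring_less[OF c] by blast
  then have "card (c ` ?T) \<le> card ({..<4} - {p})" by (intro card_mono) auto
  also have "\<dots> = 3" using p by simp
  finally have "card (c ` ?T) \<le> 3" .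
  moreover have "inj_on c ?T"
    by (rule inj_onI, rule same_card_same_colour[OF c]) auto
  ultimately show ?thesis by (simp add: card_image)
qed

text \<open>In a higher gap the sets \<open>insert t A\<close> number at least three, so they are
  all the members of their level. A point of \<open>A\<close> missing from the bottom
  \<open>C\<close> of a rerouted gap would give a member of this level not containing
  \<open>A\<close>. Hence \<open>C = A\<close>, although \<open>C\<close> has the colour of
  \<open>?M\<close> and \<open>A\<close> has colour \<open>p\<close>.\<close>

lemma gap_height_le_2:
  assumes c: "chain_colouring G 4 c" and g: "gap V G c p A B" and A: "A \<noteq> {}"
  shows "card B \<le> card A + 2"
proof (rule ccontr)
  assume "\<not> ?thesis"
  then have h: "card A + 3 \<le> card B" by simp
  let ?L = "card A + 1"
  let ?T = "{X \<in> G. card X = ?L}"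
  let ?N = "(\<lambda>t. insert t A) ` (B - A)"
  note AB = gap_psubset[OF g] and BV = gap_subset[OF g]
  have fin: "finite B" "finite A"
    using finite_subset[OF BV finV] finite_subset[of A B] AB by auto
  have NB: "A \<subset> insert t A" "insert t A \<subset> B" if "t \<in> B - A" for t
  proof -
    show "A \<subset> insert t A" using that by auto
    have "card (insert t A) < card B" using that fin h by simp
    then show "insert t A \<subset> B" using that AB by auto
  qed
  have NT: "?N \<subseteq> ?T" using gap_between(1)[OF c g NB] fin by auto
  have "inj_on (\<lambda>t. insert t A) (B - A)" by (auto intro!: inj_onI)
  then have "card ?N = card B - card A" using AB fin by (simp add: card_image card_Diff_subset)
  moreover have "card ?T \<le> 3" using gap_level_card[OF c g] h by simp
  moreover have "finite ?T" using finite_family by simp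
  ultimately have TN: "?N = ?T" using NT h card_seteq[of ?T ?N] by simp
  obtain t where t: "t \<in> B - A" using AB by blast
  let ?M = "insert t A"
  obtain C c' where C: "C \<subset> ?M" "C = {} \<or> C \<in> G \<and> c C = c ?M"
    and c': "chain_colouring G 4 c'" "gap V G c' (c ?M) C B"
    using reroute_gap[OF c g NB[OF t]] by metis
  have finC: "finite C" using C fin finite_subset[of C ?M] by auto
  have CL: "card C < ?L" using psubset_card_mono[OF _ C(1)] fin t by simp
  have "A \<subseteq> C"
  proof
    fix a assume a: "a \<in> A"
    show "a \<in> C"
    proof (rule ccontr)
      assume "a \<notin> C"
      then have "C \<subseteq> B - {a}" using C NB(2)[OF t] by auto
      moreover have "?L \<le> card (B - {a})" using a AB fin h by auto
      ultimately obtain X where X: "C \<subseteq> X" "X \<subseteq> B - {a}" "card X = ?L"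
        using exists_subset_between[of C ?L "B - {a}"] CL fin by auto
      then have "C \<subset> X" "X \<subset> B" using CL a AB by auto
      then have "X \<in> ?N" using gap_between(1)[OF c'] X TN by auto
      then show False using X a by auto
    qed
  qed
  then have "A = C" using card_seteq[OF finC] CL by simp
  \<comment> \<open>\<open>A \<noteq> {}\<close> ensures that \<open>A\<close> and \<open>C\<close>
    are members of the family with a colour, not the default bottom.\<close>
  then have "c A = c ?M" using C A by simp
  then show False using gap_between(2)[OF c g NB[OF t]] gap_bottom[OF g] A by auto
qed

text \<open>With \<open>L = card A + 1\<close>, the \<open>L\<close>-subsets \<open>B - {t}\<close> in the family are the vertices of a graph
  and the bottoms \<open>B - {s, t}\<close> of the rerouted gaps are its edges: four chains would need four
  distinct edges on at most three vertices.\<close>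

lemma gap_height_le_1:
  assumes short: "\<And>c p A B. chain_colouring G 4 c \<Longrightarrow> gap V G c p A B \<Longrightarrow> card B \<le> card A + 2"
    and c: "chain_colouring G 4 c" and g: "gap V G c p A B" and A: "A \<noteq> {}"
  shows "card B \<le> card A + 1"
proof (rule ccontr)
  assume "\<not> ?thesis"
  then have h: "card B = card A + 2" using short[OF c g] by simp
  let ?T = "{X \<in> G. card X = card A + 1}"
  note AB = gap_psubset[OF g] and BV = gap_subset[OF g]
  have fin: "finite B" "finite A"
    using finite_subset[OF BV finV] finite_subset[of A B] AB by auto
  have cA: "0 < card A" using A fin by auto
  have finT: "finite ?T" using finite_family by simp
  have T3: "card ?T \<le> 3" using gap_level_card[OF c g] h by simp
  have pairs: "\<exists>s t. s \<in> B \<and> t \<in> B \<and> s \<noteq> t \<and> C = B - {s, t}"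
    if "C \<subseteq> B" "card C = card A" for C
  proof -
    have "card (B - C) = 2" using that h fin by (simp add: card_Diff_subset finite_subset)
    then obtain s t where st: "B - C = {s, t}" "s \<noteq> t" by (auto simp: card_2_iff)
    then have "s \<in> B" "t \<in> B" by auto
    moreover have "C = B - (B - C)" using that(1) by blast
    ultimately show ?thesis using st by metis
  qed
  \<comment> \<open>In the graph, \<open>t\<close> stands for the vertex \<open>B - {t}\<close>.
    Rerouting a gap over the edge \<open>x y\<close> through the vertex \<open>y\<close> yields an
    edge \<open>y u\<close> on the chain of \<open>y\<close>.\<close>
  have step: "\<exists>u. u \<in> B \<and> u \<noteq> y \<and> B - {u} \<in> ?T \<and> B - {y, u} \<in> G \<and> d (B - {y, u}) = d (B - {y})
      \<and> chain_colouring G 4 (swap_tops (card A + 1) r (d (B - {y})) d)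
      \<and> gap V G (swap_tops (card A + 1) r (d (B - {y})) d) (d (B - {y})) (B - {y, u}) B"
    if d: "chain_colouring G 4 d" "gap V G d r (B - {x, y}) B" and xy: "x \<in> B" "y \<in> B" "x \<noteq> y"
    for d r x y
  proof -
    have M: "B - {x, y} \<subset> B - {y}" "B - {y} \<subset> B" using xy by auto
    have cM: "card (B - {y}) = card A + 1" using h xy fin by simp
    obtain C where C: "C \<subset> B - {y}" "C = {} \<or> C \<in> G \<and> d C = d (B - {y})"
      and sw: "chain_colouring G 4 (swap_tops (card A + 1) r (d (B - {y})) d)"
        "gap V G (swap_tops (card A + 1) r (d (B - {y})) d) (d (B - {y})) C B"
      using reroute_gap[OF d M] unfolding cM by metis
    have "card C < card A + 1" using psubset_card_mono[OF _ C(1)] fin cM by simp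
    \<comment> \<open>The rerouted gap also has height at most 2, so \<open>C\<close> cannot be
      smaller than \<open>A\<close>.\<close>
    then have cC: "card C = card A" using short[OF sw] h by simp
    have "C \<subseteq> B" using C(1) by blast
    from pairs[OF this cC] obtain s t where st: "s \<in> B" "t \<in> B" "s \<noteq> t" "C = B - {s, t}" by blast
    then have "y = s \<or> y = t" using C(1) xy(2) st(4) by blast
    then obtain u where u: "u \<in> B" "u \<noteq> y" "C = B - {y, u}" using st by auto
    have "C \<subset> B - {u}" "B - {u} \<subset> B" using u xy by auto
    then have "B - {u} \<in> G" by (rule gap_between(1)[OF sw])
    moreover have "card (B - {u}) = card A + 1" using h u fin by simp
    moreover have "C \<in> G \<and> d C = d (B - {y})" using C(2) cC cA by auto
    ultimately show ?thesis using u(1,2) sw unfolding u(3) by (intro exI[of _ u]) simp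
  qed
  obtain x y where xy: "x \<in> B" "y \<in> B" "x \<noteq> y" and Axy: "A = B - {x, y}"
    using pairs[of A] AB by blast
  have mid: "A \<subset> B - {x}" "B - {x} \<subset> B" "A \<subset> B - {y}" "B - {y} \<subset> B"
    using xy Axy by auto
  have "card (B - {x}) = card A + 1" "card (B - {y}) = card A + 1" using xy h fin by auto
  then have T: "B - {x} \<in> ?T" "B - {y} \<in> ?T"
    using gap_between(1)[OF c g mid(1,2)] gap_between(1)[OF c g mid(3,4)] by auto
  have cA: "c A = p" using gap_bottom[OF g] A by auto
  note cp = gap_between(2)[OF c g mid(1,2)] gap_between(2)[OF c g mid(3,4)]
  have gxy: "gap V G c p (B - {x, y}) B" and gyx: "gap V G c p (B - {y, x}) B"
    using g Axy by (simp_all add: insert_commute)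
  let ?q = "c (B - {y})"
  let ?d = "swap_tops (card A + 1) p ?q c"
  obtain u where u: "u \<in> B" "u \<noteq> y" "B - {u} \<in> ?T" "B - {y, u} \<in> G" "c (B - {y, u}) = ?q"
    and d: "chain_colouring G 4 ?d" "gap V G ?d ?q (B - {y, u}) B"
    using step[OF c gxy xy] by (elim exE conjE)
  obtain v where v: "v \<in> B" "v \<noteq> x" "B - {v} \<in> ?T" "c (B - {x, v}) = c (B - {x})"
    using step[OF c gyx xy(2,1) xy(3)[symmetric]] by (elim exE conjE)
  \<comment> \<open>Otherwise the predecessor of \<open>B - {y}\<close> would be \<open>A\<close>,
    which has colour \<open>p\<close>.\<close>
  have ux: "u \<noteq> x" using u cA cp Axy by (metis insert_commute)
  have vy: "v \<noteq> y" using v cA cp Axy by metis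
  have inj: "inj_on (\<lambda>t. B - {t}) B" by (auto intro!: inj_onI)
  have three: "w \<in> {x, y, u}" if "w \<in> B" "B - {w} \<in> ?T" for w
  proof (rule ccontr)
    assume w: "w \<notin> {x, y, u}"
    have "card ((\<lambda>t. B - {t}) ` {x, y, u, w}) = card {x, y, u, w}"
      by (rule card_image, rule inj_on_subset[OF inj]) (use xy u that in auto)
    also have "\<dots> = 4" using w xy ux u by auto
    finally have "card ((\<lambda>t. B - {t}) ` {x, y, u, w}) = 4" .
    moreover have "card ((\<lambda>t. B - {t}) ` {x, y, u, w}) \<le> card ?T"
      by (rule card_mono[OF finT]) (use T u that in auto)
    ultimately show False using T3 by simp
  qed
  \<comment> \<open>With only three vertices, both reroutings lead to the same \<open>u\<close>: the
    chains of \<open>A\<close>, \<open>B - {y}\<close> and \<open>B - {x}\<close> carry the edges of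
    the triangle \<open>x y u\<close>.\<close>
  have vu: "v = u" using three[OF v(1,3)] v(2) vy by blast
  \<comment> \<open>\<open>B - {u}\<close> is not above \<open>A\<close>, so it is reached from the
    gap over \<open>B - {y, u}\<close> in the swapped colouring \<open>?d\<close>.\<close>
  obtain w where w: "w \<in> B" "w \<noteq> u" "B - {w} \<in> ?T" "?d (B - {u, w}) = ?d (B - {u})"
    using step[OF d(1,2) xy(2) u(1) u(2)[symmetric]] by (elim exE conjE)
  have "card (B - {u, w}) = card A" using w u h fin by (simp add: card_Diff_subset)
  \<comment> \<open>Back to \<open>c\<close>: the edge lies below the level of the swap, and the
    colour of \<open>B - {u}\<close> is neither of the two exchanged ones.\<close>
  then have "?d (B - {u, w}) = c (B - {u, w})" by (simp add: swap_tops_def)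
  moreover have cu: "card (B - {u}) = card A + 1" "B - {u} \<in> G" using u by auto
  have "\<not> B - {u} \<subseteq> A" using cu card_mono[OF fin(2), of "B - {u}"] by auto
  then have "c (B - {u}) \<noteq> p" using gap_side[OF g cu(2)] u(1) by blast
  moreover have distinct: "c (B - {s}) \<noteq> c (B - {u})" if "s \<noteq> u" "s \<in> B" "B - {s} \<in> ?T" for s
    using same_card_same_colour[OF c, of "B - {s}" "B - {u}"] that cu u(1) by auto
  have "?q \<noteq> c (B - {u})" by (rule distinct) (use u xy T in auto)
  ultimately have same: "c (B - {u, w}) = c (B - {u})"
    using w(4) cu by (simp add: swap_tops_def)
  \<comment> \<open>The fourth edge must repeat a triangle edge at \<open>u\<close>, which already
    lies on the chain of \<open>B - {x}\<close> or of \<open>B - {y}\<close>.\<close>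
  have "w = x \<or> w = y" using three[OF w(1,3)] w(2) by auto
  then show False
  proof
    assume "w = x"
    then have "c (B - {x}) = c (B - {u})" using same v vu by (simp add: insert_commute)
    then show False using distinct[of x] ux xy T by auto
  next
    assume "w = y"
    then have "c (B - {y}) = c (B - {u})" using same u by (simp add: insert_commute)
    then show False using distinct[of y] u xy T by auto
  qed
qed

end

section \<open>Complementation, gaps from the bottom, and the count\<close>

lemma Diff_image_Diff_image: "G \<subseteq> Pow V \<Longrightarrow> (-) V ` (-) V ` G = G"
  by (auto simp: image_iff double_diff)

lemma chain_colouring_compl:
  assumes "chain_colouring G k c" "G \<subseteq> Pow V"
  shows "chain_colouring ((-) V ` G) k (\<lambda>X. c (V - X))"
proof -
  have [simp]: "V - (V - X) = X" if "X \<in> G" for X using that assms(2) by auto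
  show ?thesis
    using assms(1) unfolding chain_colouring_def by (simp add: image_subset_iff) blast
qed

text \<open>Makes the bounds for nonempty bottoms available for a gap from \<open>{}\<close>: if its
  top is not \<open>V\<close>, the complementary gap has a nonempty bottom.\<close>

lemma gap_compl:
  assumes "gap V G c p A B" "G \<subseteq> Pow V"
  shows "gap V ((-) V ` G) (\<lambda>X. c (V - X)) p (V - B) (V - A)"
proof -
  have [simp]: "V - (V - X) = X" if "X \<in> G" for X using that assms(2) by auto
  note gap_subset[OF assms(1)] gap_psubset[OF assms(1)]
  then have [simp]: "V - (V - A) = A" "V - (V - B) = B" "V - B \<subset> V - A" by auto
  have "V - Y \<subseteq> V - B \<or> V - A \<subseteq> V - Y" if "Y \<in> G" "c Y = p" for Y
    using gap_side[OF assms(1) that] by blast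
  then show ?thesis
    using gap_less[OF assms(1)] gap_bottom[OF assms(1)] gap_top[OF assms(1)]
    unfolding gap_def by auto
qed

context maximal_family
begin

lemma maximal_family_compl: "maximal_family V ((-) V ` G)"
proof
  have GP: "G \<subseteq> Pow V" using GV by blast
  show "finite V" by (rule finV)
  show "(-) V ` G \<subseteq> Pow V - {{}, V}" using GV by auto
  fix X c assume X: "X \<subset> V" "X \<noteq> {}" and c: "chain_colouring (insert X ((-) V ` G)) 4 c"
  have "(-) V ` insert X ((-) V ` G) = insert (V - X) G"
    using Diff_image_Diff_image[OF GP] by simp
  moreover have "insert X ((-) V ` G) \<subseteq> Pow V" using X by auto
  ultimately have "chain_colouring (insert (V - X) G) 4 (\<lambda>X. c (V - X))"
    using chain_colouring_compl[OF c] by metis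
  then have "V - X \<in> G" by (rule max[rotated 2]) (use X in auto)
  then show "X \<in> (-) V ` G" using X by (auto simp: image_iff double_diff intro!: bexI[of _ "V - X"])
qed

text \<open>An empty chain would leave all singletons strictly inside the gap, hence in
  \<open>G\<close>, while a skipped level has at most three members.\<close>

lemma gap_not_full:
  assumes c: "chain_colouring G 4 c" and V: "4 \<le> card V"
  shows "\<not> gap V G c p {} V"
proof
  assume g: "gap V G c p {} V"
  have "{v} \<in> {X \<in> G. card X = 1}" if "v \<in> V" for v
  proof -
    have "{v} \<noteq> V" using V by auto
    then show ?thesis using gap_between(1)[OF c g, of "{v}"] that by auto
  qed
  then have "card ((\<lambda>v. {v}) ` V) \<le> card {X \<in> G. card X = 1}"
    using finite_family by (intro card_mono) auto
  then have "card V \<le> card {X \<in> G. card X = 1}" by (simp add: card_image)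
  then show False using gap_level_card[OF c g, of 1] V by simp
qed

lemma gap_card_Diff:
  assumes "gap V G c p A B"
  shows "card (V - A) = card V - card A" "card (V - B) = card V - card B"
    "card A \<le> card B" "card B \<le> card V"
proof -
  have *: "A \<subseteq> B" "B \<subseteq> V" using gap_psubset[OF assms] gap_subset[OF assms] by auto
  then have "finite A" "finite B" using finV finite_subset by (metis subset_trans)+
  then show "card (V - A) = card V - card A" "card (V - B) = card V - card B"
    "card A \<le> card B" "card B \<le> card V" using * finV
    by (auto simp: card_Diff_subset card_mono)
qed

lemma gap_height:
  assumes c: "chain_colouring G 4 c" and g: "gap V G c p A B" and V: "4 \<le> card V"
  shows "card B \<le> card A + 1"
proof -
  interpret dual: maximal_family V "(-) V ` G" by (rule maximal_family_compl)
  have GP: "G \<subseteq> Pow V" using GV by blast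
  have short: "card B \<le> card A + 2"
    if c: "chain_colouring G 4 c" and g: "gap V G c p A B" for c p A B
  proof (cases "A = {}")
    case False
    then show ?thesis using gap_height_le_2[OF c g] by simp
  next
    case True
    then have "B \<noteq> V" using gap_not_full[OF c V] g by auto
    then have "V - B \<noteq> {}" using gap_subset[OF g] by auto
    then have "card (V - A) \<le> card (V - B) + 2"
      using dual.gap_height_le_2[OF chain_colouring_compl[OF c GP] gap_compl[OF g GP]] by simp
    then show ?thesis using gap_card_Diff[OF g] by simp
  qed
  \<comment> \<open>The dual use of \<open>gap_height_le_1\<close> asks for the bound for every
    colouring of the family of complements; each gap there is the complement of a gap of
    \<open>G\<close>.\<close>
  have dual_short: "card B \<le> card A + 2"
    if c: "chain_colouring ((-) V ` G) 4 c" and g: "gap V ((-) V ` G) c p A B" for c p A B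
  proof -
    have "(-) V ` G \<subseteq> Pow V" by auto
    then have "card (V - A) \<le> card (V - B) + 2"
      using short[of "\<lambda>X. c (V - X)" p "V - B" "V - A"]
        chain_colouring_compl[OF c, of V] gap_compl[OF g] Diff_image_Diff_image[OF GP] by simp
    then show ?thesis using dual.gap_card_Diff[OF g] by simp
  qed
  show ?thesis
  proof (cases "A = {}")
    case False
    show ?thesis by (rule gap_height_le_1[OF _ c g False]) (erule (1) short)
  next
    case True
    then have "B \<noteq> V" using gap_not_full[OF c V] g by auto
    then have ne: "V - B \<noteq> {}" using gap_subset[OF g] by auto
    have "card (V - A) \<le> card (V - B) + 1"
      by (rule dual.gap_height_le_1[OF _ chain_colouring_compl[OF c GP] gap_compl[OF g GP] ne])
        (erule (1) dual_short)
    then show ?thesis using gap_card_Diff[OF g] by simp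
  qed
qed

text \<open>As no gap skips a level, every pair of a level strictly between bottom and top and a
  colour is realised by a member.\<close>

lemma card_family_ge:
  assumes c: "chain_colouring G 4 c" and V: "4 \<le> card V"
  shows "4 * (card V - 1) \<le> card G"
proof -
  have "{1..<card V} \<times> {..<4} \<subseteq> (\<lambda>X. (card X, c X)) ` G"
  proof clarify
    fix L p assume L: "L \<in> {1..<card V}" and p: "p < (4::nat)"
    obtain A B where g: "gap V G c p A B" "card A < L" "L \<le> card B"
      using gap_at_level[OF c p, of L] L by auto
    then have "card B = L" using gap_height[OF c g(1) V] by simp
    moreover have "B \<in> G" "c B = p" using gap_top[OF g(1)] \<open>card B = L\<close> L by auto
    ultimately show "(L, p) \<in> (\<lambda>X. (card X, c X)) ` G" by blast
  qed
  then have "card ({1..<card V} \<times> {..<4::nat}) \<le> card ((\<lambda>X. (card X, c X)) ` G)"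
    by (intro card_mono) (use finite_family in auto)
  also have "\<dots> \<le> card G" using finite_family by (rule card_image_le)
  finally show ?thesis by simp
qed

end

section \<open>From saturated families to maximal families\<close>

lemma antichain_no_extremes:
  assumes "antichain A" "2 \<le> card A" "A \<subseteq> Pow V"
  shows "{} \<notin> A" "V \<notin> A"
proof -
  have other: "\<exists>X\<in>A. X \<noteq> M" for M
  proof (rule ccontr)
    assume "\<not> (\<exists>X\<in>A. X \<noteq> M)"
    then have "A \<subseteq> {M}" by blast
    then have "card A \<le> card {M}" by (rule card_mono[rotated]) simp
    then show False using assms(2) by simp
  qed
  show "{} \<notin> A" using other[of "{}"] antichainD[OF assms(1), of "{}"] by (metis empty_subsetI)
  show "V \<notin> A" using other[of V] antichainD[OF assms(1), of _ V] assms(3) by (metis PowD subsetD)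
qed

lemma contains_antichain_remove_extremes:
  assumes "contains_antichain k F" "2 \<le> k" "F \<subseteq> Pow V"
  shows "contains_antichain k (F - {{}, V})"
proof -
  obtain A where A: "A \<subseteq> F" "finite A" "card A = k" "antichain A"
    using assms(1) unfolding contains_antichain_def by blast
  then have "{} \<notin> A" "V \<notin> A" using antichain_no_extremes[of A V] assms by auto
  then show ?thesis using A unfolding contains_antichain_def by blast
qed

lemma contains_antichain_mono: "contains_antichain k F \<Longrightarrow> F \<subseteq> H \<Longrightarrow> contains_antichain k H"
  unfolding contains_antichain_def by blast

lemma antichain_saturated_card_ge:
  assumes sat: "antichain_saturated n 5 F" and n: "n \<ge> 5"
  shows "4 * n - 2 \<le> card F"
proof -
  let ?V = "{1..n}"
  define G where "G = F - {{}, ?V}"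
  have FP: "F \<subseteq> Pow ?V" and no: "\<not> contains_antichain 5 F"
    and s: "\<And>X. X \<subseteq> ?V \<Longrightarrow> X \<notin> F \<Longrightarrow> contains_antichain 5 (F \<union> {X})"
    using sat by (auto simp: antichain_saturated_def)
  \<comment> \<open>Bottom and top belong to no antichain of size 5, so adding them creates
    none.\<close>
  have ext: "X \<in> F" if "X \<in> {{}, ?V}" for X
  proof (rule ccontr)
    assume "X \<notin> F"
    moreover have X: "X \<subseteq> ?V" using that by auto
    ultimately have "contains_antichain 5 (F \<union> {X})" using s by blast
    then have "contains_antichain 5 (F \<union> {X} - {{}, ?V})"
      by (rule contains_antichain_remove_extremes) (use FP X in auto)
    then have "contains_antichain 5 F" by (rule contains_antichain_mono) (use that in auto)
    then show False using no by blast
  qed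
  interpret maximal_family ?V G
  proof
    show "finite ?V" "G \<subseteq> Pow ?V - {{}, ?V}" using FP by (auto simp: G_def)
    fix X c assume X: "X \<subset> ?V" "X \<noteq> {}" and c: "chain_colouring (insert X G) 4 c"
    show "X \<in> G"
    proof (rule ccontr)
      assume "X \<notin> G"
      then have "contains_antichain 5 (F \<union> {X})" using s X by (auto simp: G_def)
      then have "contains_antichain 5 (F \<union> {X} - {{}, ?V})"
        by (rule contains_antichain_remove_extremes) (use FP X in auto)
      then have "contains_antichain 5 (insert X G)"
        by (rule contains_antichain_mono) (auto simp: G_def)
      then show False using chain_colouring_not_contains_antichain[OF c] by simp
    qed
  qed
  have "\<not> contains_antichain (Suc 4) G"
    using no contains_antichain_mono[of 5 G F] by (auto simp: G_def)
  then obtain c where "chain_colouring G 4 c" using dilworth finite_family by blast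
  then have "4 * (n - 1) \<le> card G" using card_family_ge n by fastforce
  moreover have "F = insert {} (insert ?V G)" using ext by (auto simp: G_def)
  moreover have "?V \<notin> G" "{} \<notin> insert ?V G" using n by (auto simp: G_def)
  ultimately show ?thesis using finite_family by simp
qed

section \<open>Construction from cyclic intervals\<close>

text \<open>The arc of \<open>j\<close> points starting at \<open>i\<close> on the cycle of
  \<open>1\<close> to \<open>n\<close>. The second part is what wraps around; truncated subtraction
  keeps it empty as long as the arc does not pass \<open>n\<close>.\<close>

definition cyclic_interval :: "nat \<Rightarrow> nat \<Rightarrow> nat \<Rightarrow> nat set" where
  "cyclic_interval n i j = {i..<min (i + j) (n + 1)} \<union> {1..<i + j - n}"

lemma cyclic_interval_subset: "1 \<le> i \<Longrightarrow> i \<le> n \<Longrightarrow> j \<le> n \<Longrightarrow> cyclic_interval n i j \<subseteq> {1..n}"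
  by (auto simp: cyclic_interval_def)

lemma cyclic_interval_mono: "j \<le> j' \<Longrightarrow> cyclic_interval n i j \<subseteq> cyclic_interval n i j'"
  by (auto simp: cyclic_interval_def)

lemma card_cyclic_interval:
  assumes "1 \<le> i" "i \<le> n" "j \<le> n"
  shows "card (cyclic_interval n i j) = j"
proof -
  have "{i..<min (i + j) (n + 1)} \<inter> {1..<i + j - n} = {}" using assms by auto
  then show ?thesis
    using assms by (simp add: cyclic_interval_def card_Un_disjoint min_def)
qed

text \<open>The point \<open>i' - 1\<close> is outside the arc from \<open>i'\<close> because
  \<open>j < n\<close>, but the arc from \<open>i\<close> contains it as soon as it contains
  \<open>i'\<close>.\<close>

lemma cyclic_interval_inj_less:
  assumes "1 \<le> i" "i < i'" "i' \<le> n" "1 \<le> j" "j < n"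
  shows "cyclic_interval n i j \<noteq> cyclic_interval n i' j"
proof
  assume eq: "cyclic_interval n i j = cyclic_interval n i' j"
  have "i' \<in> cyclic_interval n i' j" using assms by (auto simp: cyclic_interval_def)
  then have "i' < i + j" using assms unfolding eq[symmetric] by (auto simp: cyclic_interval_def)
  moreover have "i' - 1 \<notin> cyclic_interval n i' j" using assms by (auto simp: cyclic_interval_def)
  then have "i' - 1 \<notin> cyclic_interval n i j" using eq by simp
  ultimately show False using assms by (auto simp: cyclic_interval_def)
qed

lemma cyclic_interval_inj:
  assumes "cyclic_interval n i j = cyclic_interval n i' j'"
    and "1 \<le> i" "i \<le> n" "1 \<le> i'" "i' \<le> n" "1 \<le> j" "j < n" "1 \<le> j'" "j' < n"
  shows "i = i' \<and> j = j'"
proof -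
  have "j = j'"
    using assms card_cyclic_interval[of i n j] card_cyclic_interval[of i' n j'] by simp
  then show ?thesis
    using assms cyclic_interval_inj_less[of i i' n j] cyclic_interval_inj_less[of i' i n j]
    by (metis linorder_neqE_nat)
qed

lemma antichain_saturated_small:
  assumes n: "n \<ge> 5"
  shows "\<exists>F. antichain_saturated n 5 F \<and> card F = 4 * n - 2"
proof -
  let ?V = "{1..n}"
  let ?I = "{1..4} \<times> {1..<n}"
  let ?f = "\<lambda>(i, j). cyclic_interval n i j"
  define G where "G = ?f ` ?I"
  define F where "F = insert {} (insert ?V G)"
  have inj: "inj_on ?f ?I"
  proof (rule inj_onI, clarify)
    fix i j i' j' assume *: "i \<in> {1..4}" "j \<in> {1..<n}" "i' \<in> {1..4}" "j' \<in> {1..<n}"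
      "cyclic_interval n i j = cyclic_interval n i' j'"
    show "i = i' \<and> j = j'"
      using cyclic_interval_inj[OF *(5)] *(1-4) n by auto
  qed
  have cardG: "0 < card X \<and> card X < n" if "X \<in> G" for X
    using that n card_cyclic_interval unfolding G_def by auto
  have GV: "G \<subseteq> Pow ?V"
  proof
    fix X assume "X \<in> G"
    then obtain i j where "i \<in> {1..4}" "j \<in> {1..<n}" "X = cyclic_interval n i j"
      unfolding G_def by auto
    then show "X \<in> Pow ?V" using cyclic_interval_subset[of i n j] n by auto
  qed
  have FV: "F \<subseteq> Pow ?V" using GV by (auto simp: F_def)
  \<comment> \<open>The colour is the starting point, recovered by inverting the parametrisation and
    shifted from 1 to 4 down to 0 to 3.\<close>
  have "chain_colouring G 4 (\<lambda>X. fst (the_inv_into ?I ?f X) - 1)"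
  proof -
    have inv: "the_inv_into ?I ?f (cyclic_interval n i j) = (i, j)"
      if "i \<in> {1..4}" "j \<in> {1..<n}" for i j
      using the_inv_into_f_f[OF inj, of "(i, j)"] that by auto
    have "X \<subseteq> Y \<or> Y \<subseteq> X" if X: "X \<in> G" and Y: "Y \<in> G"
      and eq: "fst (the_inv_into ?I ?f X) - 1 = fst (the_inv_into ?I ?f Y) - 1" for X Y
    proof -
      obtain i j i' j' where *: "i \<in> {1..4}" "j \<in> {1..<n}" "i' \<in> {1..4}" "j' \<in> {1..<n}"
        and XY: "X = cyclic_interval n i j" "Y = cyclic_interval n i' j'"
        using X Y unfolding G_def by auto
      have "i - 1 = i' - 1" using eq inv[OF *(1,2)] inv[OF *(3,4)] unfolding XY by simp
      then have "i = i'" using * by auto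
      then show ?thesis unfolding XY using cyclic_interval_mono nat_le_linear by metis
    qed
    moreover have "fst (the_inv_into ?I ?f X) - 1 < 4" if "X \<in> G" for X
      using that inv unfolding G_def by auto
    ultimately show ?thesis unfolding chain_colouring_def by blast
  qed
  then have "\<not> contains_antichain 5 G"
    using chain_colouring_not_contains_antichain[of G 4] by simp
  moreover have "F - {{}, ?V} \<subseteq> G" by (auto simp: F_def)
  ultimately have "\<not> contains_antichain 5 F"
    using contains_antichain_remove_extremes[of 5 F ?V] FV
      contains_antichain_mono[of 5 "F - {{}, ?V}" G] by auto
  moreover have "contains_antichain 5 (F \<union> {X})" if X: "X \<subseteq> ?V" "X \<notin> F" for X
  proof -
    let ?A = "(\<lambda>i. cyclic_interval n i (card X)) ` {1..4}"
    have X': "X \<noteq> {}" "X \<noteq> ?V" using X by (auto simp: F_def)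
    have finX: "finite X" using X finite_subset by blast
    have cX: "1 \<le> card X" "card X < n"
      using X' X(1) finX psubset_card_mono[of ?V X] by (auto simp: Suc_le_eq card_gt_0_iff)
    have AG: "?A \<subseteq> G" using cX unfolding G_def by auto
    have cA: "card Y = card X \<and> finite Y" if "Y \<in> insert X ?A" for Y
      using that cX n finX card_cyclic_interval[of _ n "card X"] by (auto simp: cyclic_interval_def)
    have "inj_on (\<lambda>i. cyclic_interval n i (card X)) {1..4}"
      using cyclic_interval_inj[of n _ "card X" _ "card X"] cX n by (auto intro!: inj_onI)
    then have "card ?A = 4" by (simp add: card_image)
    moreover have "X \<notin> ?A" using X AG by (auto simp: F_def)
    ultimately have "card (insert X ?A) = 5" by simp
    moreover have "antichain (insert X ?A)"
      by (rule antichainI) (metis cA card_subset_eq)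
    moreover have "insert X ?A \<subseteq> F \<union> {X}" using AG by (auto simp: F_def)
    ultimately show ?thesis unfolding contains_antichain_def
      by (metis finite_atLeastAtMost finite_imageI finite_insert)
  qed
  ultimately have "antichain_saturated n 5 F"
    using FV by (simp add: antichain_saturated_def)
  moreover have "card F = 4 * n - 2"
  proof -
    have "card G = 4 * (n - 1)"
      unfolding G_def card_image[OF inj] by simp
    moreover have "finite G" by (simp add: G_def)
    moreover have "?V \<notin> G" "{} \<notin> insert ?V G" using cardG n by fastforce+
    ultimately show ?thesis using n by (simp add: F_def)
  qed
  ultimately show ?thesis by blast
qed

theorem theorem2:
  fixes n :: nat
  assumes "n \<ge> 5"
  shows "sat_star n 5 = 4 * n - 2"
  unfolding sat_star_def
  by (rule Least_equality)
    (use antichain_saturated_small[OF assms] antichain_saturated_card_ge[OF _ assms] in auto)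

end
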